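(* Let $\mathcal C_A\subset\mathbb R^{p_A}$ be nonempty, compact and convex, let $\mathcal C=\mathcal C_A\times\mathbb R^{p_B}\subseteq\mathbb R^{p}$ with $p=p_A+p_B$, and let $\widehat f_U$ be the reduced objective $\widehat f_U(\theta)=f_U(\widehat w(\theta),\theta)$ described in the context. Let $\{\theta^{(t)}\}$ be the sequence generated from some $\theta^{(0)}\in\mathcal C$ by the CR-VarPro algorithm described in the context, with search directions $d^{(t)}$ and gaps $g_t=-\langle\nabla\widehat f_U(\theta^{(t)}),d^{(t)}\rangle$. Assume that $\nabla\widehat f_U$ is Lipschitz continuous with constant $L>0$ on the level set generated by the algorithm, $\{\theta\in\mathcal C:\widehat f_U(\theta)\le\widehat f_U(\theta^{(0)})\}$, and that $\widehat f_U$ is bounded below on $\mathcal C$, with $\widehat f_U^*:=\inf_{\theta\in\mathcal C}\widehat f_U(\theta)$. Let $\Delta_A:=\max_{\theta_A,\tilde\theta_A\in\mathcal C_A}\|\theta_A-\tilde\theta_A\|$ and $\bar\Delta:=\sqrt{\Delta_A^2+1}$. Assume that, for some fixed $\rho>0$, the stepsizes $\alpha_t\in(0,1]$ satisfy at every iteration $t$ $$\alpha_t\ \ge\ \bar\alpha_t:=\min\Big\{1,\frac{g_t}{L\bar\Delta^2}\Big\}\qquad\text{and}\qquad \widehat f_U(\theta^{(t)})-\widehat f_U(\theta^{(t+1)})\ \ge\ \rho\,\bar\alpha_t\,g_t .$$ Define $g_T^*:=\min_{0\le t\le T-1}g_t$. Then, for every $T\in\mathbb N$, $T\ge1$, $$g_T^*\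 \le\ \max\left\{\sqrt{\frac{L\bar\Delta^2\big(\widehat f_U(\theta^{(0)})-\widehat f_U^*\big)}{\rho\,T}},\ \frac{2\big(\widehat f_U(\theta^{(0)})-\widehat f_U^*\big)}{T}\right\}.$$
   Context: All norms are Euclidean. Reduced objective. Let $M_L,M_U:\mathbb R^p\to\mathbb R^{m\times N}$, $y_L,y_U:\mathbb R^p\to\mathbb R^m$, $R:\mathbb R^p\to\mathbb R$, $\mu\ge0$, with $M_L(\theta),M_U(\theta)$ of full column rank for all relevant $\theta$ (in particular all $\theta\in\mathcal C$). Put $f_U(w,\theta)=\frac12\|M_U(\theta)w-y_U(\theta)\|^2+\frac{\mu}{2}R(\theta)$ and $f_L(w,\theta)=\frac12\|M_L(\theta)w-y_L(\theta)\|^2$, let $\widehat w(\theta)=\arg\min_{w\in\mathbb R^N}f_L(w,\theta)$ (unique), and $\widehat f_U(\theta)=f_U(\widehat w(\theta),\theta)$, which is differentiable. The problem is $\min_{\theta\in\mathcal C}\widehat f_U(\theta)$. Write $\theta=(\theta_A,\theta_B)\in\mathbb R^{p_A}\times\mathbb R^{p_B}$ and $\nabla\widehat f_U=(\nabla_{\theta_A}\widehat f_U,\nabla_{\theta_B}\widehat f_U)$. CR-VarPro algorithm. Start from $\theta^{(0)}\in\mathcal C$. At iteration $t=0,1,2,\dots$, compute $\bar\theta^{(t)}=(\bar\theta_A^{(t)},\bar\theta_B^{(t)})$ with $$\bar\theta_A^{(t)}\in\arg\min_{\theta_A\in\mathcal C_A}\langle\theta_A,\nabla_{\theta_A}\widehat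 f_U(\theta^{(t)})\rangle,\qquad \bar\theta_B^{(t)}\in\arg\min_{\|\theta_B-\theta_B^{(t)}\|\le1}\langle\theta_B,\nabla_{\theta_B}\widehat f_U(\theta^{(t)})\rangle,$$ and set $d^{(t)}=\bar\theta^{(t)}-\theta^{(t)}$ and $g_t=-\langle\nabla\widehat f_U(\theta^{(t)}),d^{(t)}\rangle$. Stop if $\theta^{(t)}$ is stationary (equivalently $g_t=0$); otherwise choose a stepsize $\alpha_t\in(0,1]$ and set $\theta^{(t+1)}=\theta^{(t)}+\alpha_td^{(t)}$. The bound for a given $T$ concerns runs in which iterations $0,\dots,T-1$ are carried out. *)

theory Defs
  imports "HOL-Analysis.Analysis"
begin

definition lower_obj ::
  "('p \<Rightarrow> real^'n^'m) \<Rightarrow> ('p \<Rightarrow> real^'m) \<Rightarrow> real^'n \<Rightarrow> 'p \<Rightarrow> real" where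
  "lower_obj M\<^sub>L y\<^sub>L w \<theta> = 1/2 * (norm (M\<^sub>L \<theta> *v w - y\<^sub>L \<theta>))\<^sup>2"

definition upper_obj ::
  "('p \<Rightarrow> real^'n^'m) \<Rightarrow> ('p \<Rightarrow> real^'m) \<Rightarrow> ('p \<Rightarrow> real) \<Rightarrow> real \<Rightarrow> real^'n \<Rightarrow> 'p \<Rightarrow> real" where
  "upper_obj M\<^sub>U y\<^sub>U R \<mu> w \<theta> = 1/2 * (norm (M\<^sub>U \<theta> *v w - y\<^sub>U \<theta>))\<^sup>2 + \<mu> / 2 * R \<theta>"

(* A minimizer always exists (linear least squares); it is unique, so that the choice made by
   ARG_MIN is immaterial, where M\<^sub>L \<theta> has full column rank. *)
definition w_hat ::
  "('p \<Rightarrow> real^'n^'m) \<Rightarrow> ('p \<Rightarrow> real^'m) \<Rightarrow> 'p \<Rightarrow> real^'n" where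
  "w_hat M\<^sub>L y\<^sub>L \<theta> = (ARG_MIN (\<lambda>w. lower_obj M\<^sub>L y\<^sub>L w \<theta>) w. True)"

definition reduced_obj ::
  "('p \<Rightarrow> real^'n^'m) \<Rightarrow> ('p \<Rightarrow> real^'m) \<Rightarrow> ('p \<Rightarrow> real^'n^'m) \<Rightarrow> ('p \<Rightarrow> real^'m) \<Rightarrow>
   ('p \<Rightarrow> real) \<Rightarrow> real \<Rightarrow> 'p \<Rightarrow> real" where
  "reduced_obj M\<^sub>L y\<^sub>L M\<^sub>U y\<^sub>U R \<mu> \<theta> = upper_obj M\<^sub>U y\<^sub>U R \<mu> (w_hat M\<^sub>L y\<^sub>L \<theta>) \<theta>"

(* Meaningful only at points of differentiability, where the gradient exists and is unique. *)
definition grad :: "('p::euclidean_space \<Rightarrow> real) \<Rightarrow> 'p \<Rightarrow> 'p" where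
  "grad F \<theta> = (THE D. GDERIV F \<theta> :> D)"

definition stationary_on :: "('p::euclidean_space) set \<Rightarrow> ('p \<Rightarrow> real) \<Rightarrow> 'p \<Rightarrow> bool" where
  "stationary_on C F \<theta> \<longleftrightarrow> \<theta> \<in> C \<and> (\<forall>\<eta>\<in>C. inner (grad F \<theta>) (\<eta> - \<theta>) \<ge> 0)"

(* Iterations 0, ..., T - 1 of CR-VarPro are carried out, i.e. the stopping test fails at each
   of them, with iterates \<theta> t, linear minimization outputs \<theta>bar t and stepsizes \<alpha> t.
   Nothing is required of the sequences beyond \<theta> T. *)
definition cr_varpro_run ::
  "('a::euclidean_space) set \<Rightarrow> ('a \<times> 'b::euclidean_space \<Rightarrow> real) \<Rightarrow> nat \<Rightarrow>
   (nat \<Rightarrow> 'a \<times> 'b) \<Rightarrow> (nat \<Rightarrow> 'a \<times> 'b) \<Rightarrow> (nat \<Rightarrow> real) \<Rightarrow> bool" where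
  "cr_varpro_run CA F T \<theta> \<theta>bar \<alpha> \<longleftrightarrow>
     \<theta> 0 \<in> CA \<times> UNIV \<and>
     (\<forall>t<T.
        \<not> stationary_on (CA \<times> UNIV) F (\<theta> t) \<and>
        is_arg_min (\<lambda>a. inner a (fst (grad F (\<theta> t)))) (\<lambda>a. a \<in> CA) (fst (\<theta>bar t)) \<and>
        is_arg_min (\<lambda>b. inner b (snd (grad F (\<theta> t))))
                   (\<lambda>b. norm (b - snd (\<theta> t)) \<le> 1) (snd (\<theta>bar t)) \<and>
        0 < \<alpha> t \<and> \<alpha> t \<le> 1 \<and>
        \<theta> (Suc t) = \<theta> t + \<alpha> t *\<^sub>R (\<theta>bar t - \<theta> t))"

end

theory Submission
  imports Defs
begin

text \<open>
  Each iteration decreases the objective by at least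
  \<open>min (g t / 2) (\<rho> * (g t)\<^sup>2 / (L * \<Delta>bar\<^sup>2))\<close>, and summing over the iterations yields
  the bound. If \<open>\<alpha>bar t < 1\<close>, this is the decrease assumption. If \<open>\<alpha>bar t = 1\<close>, the full step is
  taken, \<open>g t \<ge> L * \<Delta>bar\<^sup>2\<close>, and the descent inequality
  \<open>F (\<theta> + d) \<le> F \<theta> - g + L / 2 * (norm d)\<^sup>2\<close> gives a decrease of \<open>g t / 2\<close>. The gradient is Lipschitz only on
  a level set, which need not be convex; the descent inequality itself shows that the segment
  never leaves the level set.
\<close>

text \<open>\<open>grad\<close> is a definite description, so it says something only after existence
  and uniqueness are settled. Existence is the Riesz representation of the derivative, written out
  in \<open>Basis\<close>; uniqueness comes from that of the derivative.\<close>

lemma GDERIV_grad: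
  fixes F :: "'p::euclidean_space \<Rightarrow> real"
  assumes "F differentiable (at x)"
  shows "GDERIV F x :> grad F x"
proof -
  obtain f' where f': "(F has_derivative f') (at x)"
    using assms by (auto simp: differentiable_def)
  then interpret linear f'
    by (rule has_derivative_linear)
  define D where "D = (\<Sum>b\<in>Basis. f' b *\<^sub>R b)"
  have "f' h = inner h D" for h
  proof -
    have "f' h = f' (\<Sum>b\<in>Basis. inner h b *\<^sub>R b)"
      by (simp add: euclidean_representation)
    also have "\<dots> = inner h D"
      by (simp add: D_def sum scale inner_sum_right mult.commute)
    finally show ?thesis .
  qed
  then have "f' = (\<lambda>h. inner h D)"
    by blast
  then have ex: "GDERIV F x :> D"
    using f' by (simp add: gderiv_def)
  have "E = D" if "GDERIV F x :> E" for E
    using has_derivative_unique[OF that[unfolded gderiv_def] ex[unfolded gderiv_def]]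
    by (simp add: fun_eq_iff vector_eq_ldot)
  then have "grad F x = D"
    unfolding grad_def using ex by (intro the_equality)
  with ex show ?thesis
    by simp
qed

text \<open>The derivative bound is available only where \<open>\<phi>\<close> lies below its initial value, so the proof
  looks at the first return to that value.\<close>

lemma descent_on_sublevel:
  fixes \<phi> \<phi>' :: "real \<Rightarrow> real"
  assumes deriv: "\<And>s. 0 \<le> s \<Longrightarrow> s \<le> 1 \<Longrightarrow> (\<phi> has_real_derivative \<phi>' s) (at s)"
    and init: "\<phi>' 0 = - g" and "0 < g" "K \<le> g"
    and bound: "\<And>s. 0 \<le> s \<Longrightarrow> s \<le> 1 \<Longrightarrow> \<phi> s \<le> \<phi> 0 \<Longrightarrow> \<phi>' s \<le> - g + K * s"
  shows "\<phi> 1 \<le> \<phi> 0 - g + K / 2"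
proof -
  have cont: "continuous_on {0..1} \<phi>"
    by (rule DERIV_continuous_on[where D = \<phi>'])
      (auto intro: has_field_derivative_at_within deriv)
  \<comment> \<open>The hypothesis concerns only points strictly before \<open>s\<close>, so the
    estimate also holds at a first return time, where \<open>\<phi>\<close> is no longer known to
    lie below its initial value.\<close>
  have descent: "\<phi> s \<le> \<phi> 0 - s * g + K * s\<^sup>2 / 2"
    if s: "0 < s" "s \<le> 1" and below: "\<And>r. 0 < r \<Longrightarrow> r < s \<Longrightarrow> \<phi> r \<le> \<phi> 0" for s
  proof -
    let ?\<psi> = "\<lambda>r. \<phi> r + r * g - K * r\<^sup>2 / 2"
    have "?\<psi> s \<le> ?\<psi> 0"
    proof (rule DERIV_nonpos_imp_decreasing_open[where f = ?\<psi>])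
      show "\<exists>y. (?\<psi> has_real_derivative y) (at r) \<and> y \<le> 0" if r: "0 < r" "r < s" for r
      proof (intro exI conjI)
        show "(?\<psi> has_real_derivative \<phi>' r + g - K * r) (at r)"
          using r s by (auto intro!: derivative_eq_intros deriv)
        show "\<phi>' r + g - K * r \<le> 0"
          using bound[of r] below[of r] r s by simp
      qed
      show "continuous_on {0..s} ?\<psi>"
        using s by (intro continuous_intros continuous_on_subset[OF cont]) auto
    qed (use s in simp)
    then show ?thesis
      by simp
  qed
  have stay: "\<phi> s < \<phi> 0" if s: "0 < s" "s \<le> 1" for s
  proof (rule ccontr)
    assume "\<not> \<phi> s < \<phi> 0"
    \<comment> \<open>The negative initial slope keeps \<open>\<phi>\<close> below
      \<open>\<phi> 0\<close> just after 0. Cutting \<open>S\<close> off at this \<delta> excludes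
      the trivial point 0, so its least element is a positive return time.\<close>
    have "(\<phi> has_real_derivative - g) (at 0)"
      using deriv[of 0] init by simp
    from DERIV_neg_dec_right[OF this] \<open>0 < g\<close>
    obtain \<delta> where \<delta>: "0 < \<delta>" "\<And>h. 0 < h \<Longrightarrow> h < \<delta> \<Longrightarrow> \<phi> h < \<phi> 0"
      by auto
    define S where "S = {\<delta>..1} \<inter> \<phi> -` {\<phi> 0..}"
    have "continuous_on {\<delta>..1} \<phi>"
      using \<delta> by (intro continuous_on_subset[OF cont]) auto
    then have "closed S"
      unfolding S_def by (rule continuous_closed_preimage) auto
    then have "compact S"
      unfolding compact_eq_bounded_closed S_def using bounded_closed_interval[of \<delta> 1]
      by (auto intro: bounded_subset)
    moreover have "s \<in> S"
      using \<open>\<not> \<phi> s < \<phi> 0\<close> \<delta>(2)[of s] s by (force simp: S_def)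
    ultimately obtain r where r: "r \<in> S" "\<And>q. q \<in> S \<Longrightarrow> r \<le> q"
      using compact_attains_inf[of S] by blast
    have "\<phi> r \<le> \<phi> 0 - r * g + K * r\<^sup>2 / 2"
    proof (rule descent)
      fix q
      assume q: "0 < q" "q < r"
      then have "q \<notin> S"
        using r(2)[of q] by auto
      with q r(1) have "q < \<delta> \<or> \<phi> q < \<phi> 0"
        by (auto simp: S_def)
      then show "\<phi> q \<le> \<phi> 0"
        using \<delta>(2)[of q] q by auto
    qed (use r \<delta> in \<open>auto simp: S_def\<close>)
    \<comment> \<open>From \<open>K \<le> g\<close> and \<open>r \<le> 1\<close>. The quadratic term
      then cancels at most half of \<open>r * g\<close>, so \<open>\<phi> r < \<phi> 0\<close>,
      contradicting the return at \<open>r\<close>.\<close>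
    moreover have "K * r\<^sup>2 \<le> g * r"
    proof -
      have "K * r\<^sup>2 \<le> g * r\<^sup>2"
        using \<open>K \<le> g\<close> by (simp add: mult_right_mono)
      also have "\<dots> \<le> g * r"
        using r \<delta> \<open>0 < g\<close> by (auto simp: S_def power2_eq_square mult_left_le)
      finally show ?thesis .
    qed
    moreover have "0 < r * g" "\<phi> 0 \<le> \<phi> r"
      using r \<delta> \<open>0 < g\<close> by (auto simp: S_def)
    ultimately show False
      by (simp add: mult.commute)
  qed
  show ?thesis
    using descent[of 1] stay by force
qed

text \<open>Restricting \<open>F\<close> to the segment gives a one-dimensional descent problem with
  curvature \<open>L * D\<close>. As \<open>L * D\<close> is at most the gap, the quadratic term
  costs no more than half of the gap.\<close>

lemma full_step_descent:
  fixes F :: "'p::euclidean_space \<Rightarrow> real"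
  assumes diff: "\<And>\<eta>. \<eta> \<in> C \<Longrightarrow> F differentiable (at \<eta>)"
    and "convex C" "x \<in> C" "x + d \<in> C"
    and lip: "L-lipschitz_on {\<eta> \<in> C. F \<eta> \<le> c} (grad F)"
    and "F x \<le> c" "0 < L" "(norm d)\<^sup>2 \<le> D"
    and gap: "0 < - inner (grad F x) d" "L * D \<le> - inner (grad F x) d"
  shows "F (x + d) \<le> F x + inner (grad F x) d / 2"
proof -
  let ?\<phi> = "\<lambda>s. F (x + s *\<^sub>R d)"
  let ?\<phi>' = "\<lambda>s. inner (grad F (x + s *\<^sub>R d)) d"
  have mem: "x + s *\<^sub>R d \<in> C" if "0 \<le> s" "s \<le> 1" for s
    using convexD_alt[OF \<open>convex C\<close> \<open>x \<in> C\<close> \<open>x + d \<in> C\<close> that] by (simp add: algebra_simps)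
  have "?\<phi> 1 \<le> ?\<phi> 0 - (- inner (grad F x) d) + L * D / 2"
  proof (rule descent_on_sublevel[where \<phi>' = ?\<phi>'])
    fix s :: real
    assume s: "0 \<le> s" "s \<le> 1"
    have "((\<lambda>s. x + s *\<^sub>R d) has_vector_derivative d) (at s)"
      by (auto intro!: derivative_eq_intros)
    moreover have "(F has_derivative (\<lambda>h. inner h (grad F (x + s *\<^sub>R d))))
        (at (x + s *\<^sub>R d) within range (\<lambda>s. x + s *\<^sub>R d))"
      using GDERIV_grad[OF diff[OF mem[OF s]]] unfolding gderiv_def
      by (rule has_derivative_at_withinI)
    ultimately have "(F \<circ> (\<lambda>s. x + s *\<^sub>R d) has_vector_derivative inner d (grad F (x + s *\<^sub>R d))) (at s)"
      by (rule vector_derivative_diff_chain_within)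
    then show "(?\<phi> has_real_derivative ?\<phi>' s) (at s)"
      by (simp add: has_real_derivative_iff_has_vector_derivative o_def inner_commute)
    \<comment> \<open>This puts \<open>x + s *\<^sub>R d\<close> into the level set along with
      \<open>x\<close>. The Lipschitz bound compares just these two points, so convexity of the
      level set does not enter.\<close>
    assume "?\<phi> s \<le> ?\<phi> 0"
    then have "x + s *\<^sub>R d \<in> {\<eta> \<in> C. F \<eta> \<le> c}" "x \<in> {\<eta> \<in> C. F \<eta> \<le> c}"
      using mem[OF s] \<open>x \<in> C\<close> \<open>F x \<le> c\<close> by auto
    from lipschitz_onD[OF lip this] s
    have "norm (grad F (x + s *\<^sub>R d) - grad F x) \<le> L * (s * norm d)"
      by (simp add: dist_norm)
    then have "norm (grad F (x + s *\<^sub>R d) - grad F x) * norm d \<le> L * (s * norm d) * norm d"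
      by (rule mult_right_mono) simp
    then have "inner (grad F (x + s *\<^sub>R d) - grad F x) d \<le> L * (s * norm d) * norm d"
      using norm_cauchy_schwarz order_trans by blast
    also have "\<dots> = L * s * (norm d)\<^sup>2"
      by (simp add: power2_eq_square)
    also have "\<dots> \<le> L * s * D"
      using s \<open>0 < L\<close> \<open>(norm d)\<^sup>2 \<le> D\<close> by (simp add: mult_left_mono)
    finally show "?\<phi>' s \<le> - (- inner (grad F x) d) + L * D * s"
      by (simp add: inner_diff_left mult.commute mult.left_commute)
  qed (use gap in auto)
  then show ?thesis
    using gap by simp
qed

text \<open>The guaranteed decrease is monotone in a nonnegative gap, so every gap may be replaced
  by the smallest one. Telescoping bounds \<open>T\<close> equal terms by \<open>v 0 - m\<close>,
  and solving for the gap in either branch of the \<open>min\<close> gives one entry of the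
  \<open>max\<close>.\<close>

lemma min_gap_le:
  fixes g v :: "nat \<Rightarrow> real"
  assumes "T \<ge> 1" "0 < \<rho>" "0 < K"
    and nonneg: "\<And>t. t < T \<Longrightarrow> 0 \<le> g t"
    and decrease: "\<And>t. t < T \<Longrightarrow> min (g t / 2) (\<rho> * (g t)\<^sup>2 / K) \<le> v t - v (Suc t)"
    and "m \<le> v T"
  shows "(MIN t\<in>{..<T}. g t) \<le> max (sqrt (K * (v 0 - m) / (\<rho> * real T))) (2 * (v 0 - m) / real T)"
proof -
  define \<gamma> where "\<gamma> = (MIN t\<in>{..<T}. g t)"
  have \<gamma>_le: "\<gamma> \<le> g t" if "t < T" for t
    unfolding \<gamma>_def using that by (intro Min_le) auto
  have "0 \<le> \<gamma>"
    unfolding \<gamma>_def using \<open>T \<ge> 1\<close> nonneg by (subst Min_ge_iff) (auto simp: lessThan_empty_iff)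
  have "min (\<gamma> / 2) (\<rho> * \<gamma>\<^sup>2 / K) \<le> v t - v (Suc t)" if t: "t < T" for t
  proof -
    have "\<gamma>\<^sup>2 \<le> (g t)\<^sup>2"
      using \<gamma>_le[OF t] \<open>0 \<le> \<gamma>\<close> by (rule power_mono)
    then have "\<rho> * \<gamma>\<^sup>2 / K \<le> \<rho> * (g t)\<^sup>2 / K"
      using \<open>0 < \<rho>\<close> \<open>0 < K\<close> by (intro divide_right_mono mult_left_mono) auto
    then show ?thesis
      using decrease[OF t] \<gamma>_le[OF t] by linarith
  qed
  then have "(\<Sum>t<T. min (\<gamma> / 2) (\<rho> * \<gamma>\<^sup>2 / K)) \<le> (\<Sum>t<T. v t - v (Suc t))"
    by (intro sum_mono) auto
  then have total: "real T * min (\<gamma> / 2) (\<rho> * \<gamma>\<^sup>2 / K) \<le> v 0 - m"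
    using \<open>m \<le> v T\<close> by (simp add: sum_lessThan_telescope')
  show ?thesis
  proof (cases "\<gamma> / 2 \<le> \<rho> * \<gamma>\<^sup>2 / K")
    case True
    then have "\<gamma> \<le> 2 * (v 0 - m) / real T"
      using total \<open>T \<ge> 1\<close> by (simp add: min_def field_simps)
    then show ?thesis
      by (simp add: \<gamma>_def)
  next
    case False
    then have "\<gamma>\<^sup>2 \<le> K * (v 0 - m) / (\<rho> * real T)"
      using total \<open>T \<ge> 1\<close> \<open>0 < \<rho>\<close> \<open>0 < K\<close> by (simp add: min_def field_simps)
    then have "\<gamma> \<le> sqrt (K * (v 0 - m) / (\<rho> * real T))"
      by (rule real_le_rsqrt)
    then show ?thesis
      by (simp add: \<gamma>_def)
  qed
qed

theorem theorem5p1: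
  fixes M\<^sub>L M\<^sub>U :: "(real^'a) \<times> (real^'b) \<Rightarrow> real^'n^'m"
    and y\<^sub>L y\<^sub>U :: "(real^'a) \<times> (real^'b) \<Rightarrow> real^'m"
    and R :: "(real^'a) \<times> (real^'b) \<Rightarrow> real"
    and \<mu> L \<rho> :: real
    and CA :: "(real^'a) set"
    and C :: "((real^'a) \<times> (real^'b)) set"
    and F :: "(real^'a) \<times> (real^'b) \<Rightarrow> real"
    and \<theta> \<theta>bar d :: "nat \<Rightarrow> (real^'a) \<times> (real^'b)"
    and \<alpha> \<alpha>bar g :: "nat \<Rightarrow> real"
    and Fstar \<Delta>A \<Delta>bar :: real
    and T :: nat
  defines "C \<equiv> CA \<times> UNIV"
    and "F \<equiv> reduced_obj M\<^sub>L y\<^sub>L M\<^sub>U y\<^sub>U R \<mu>"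
    and "Fstar \<equiv> (INF \<eta>\<in>C. F \<eta>)"
    and "\<Delta>A \<equiv> diameter CA"
    and "\<Delta>bar \<equiv> sqrt (\<Delta>A\<^sup>2 + 1)"
    and "d \<equiv> (\<lambda>t. \<theta>bar t - \<theta> t)"
    and "g \<equiv> (\<lambda>t. - inner (grad F (\<theta> t)) (d t))"
    and "\<alpha>bar \<equiv> (\<lambda>t. min 1 (g t / (L * \<Delta>bar\<^sup>2)))"
  assumes CA: "CA \<noteq> {}" "compact CA" "convex CA"
    and mu: "\<mu> \<ge> 0"
    and full_rank: "\<And>\<eta>. \<eta> \<in> C \<Longrightarrow> rank (M\<^sub>L \<eta>) = CARD('n)"
                   "\<And>\<eta>. \<eta> \<in> C \<Longrightarrow> rank (M\<^sub>U \<eta>) = CARD('n)"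
    and diff: "\<And>\<eta>. \<eta> \<in> C \<Longrightarrow> F differentiable (at \<eta>)"
    and bdd: "bdd_below (F ` C)"
    and T: "T \<ge> 1"
    and run: "cr_varpro_run CA F T \<theta> \<theta>bar \<alpha>"
    and L: "L > 0"
    and lipschitz: "L-lipschitz_on {\<eta> \<in> C. F \<eta> \<le> F (\<theta> 0)} (grad F)"
    and rho: "\<rho> > 0"
    and step: "\<And>t. t < T \<Longrightarrow> \<alpha> t \<ge> \<alpha>bar t"
    and decrease: "\<And>t. t < T \<Longrightarrow> F (\<theta> t) - F (\<theta> (Suc t)) \<ge> \<rho> * \<alpha>bar t * g t"
  shows "(MIN t\<in>{..<T}. g t) \<le>
           max (sqrt (L * \<Delta>bar\<^sup>2 * (F (\<theta> 0) - Fstar) / (\<rho> * real T)))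
               (2 * (F (\<theta> 0) - Fstar) / real T)"
proof -
  have "convex C"
    unfolding C_def using CA by (intro convex_Times) auto
  have oracle_A: "is_arg_min (\<lambda>a. inner a (fst (grad F (\<theta> t)))) (\<lambda>a. a \<in> CA) (fst (\<theta>bar t))"
    and oracle_B: "is_arg_min (\<lambda>b. inner b (snd (grad F (\<theta> t))))
      (\<lambda>b. norm (b - snd (\<theta> t)) \<le> 1) (snd (\<theta>bar t))"
    and \<alpha>: "0 < \<alpha> t" "\<alpha> t \<le> 1"
    and update: "\<theta> (Suc t) = \<theta> t + \<alpha> t *\<^sub>R d t" if "t < T" for t
    using run that by (auto simp: cr_varpro_run_def d_def)
  have \<theta>bar_C: "\<theta> t + d t \<in> C" if "t < T" for t
    using oracle_A[OF that] by (auto simp: is_arg_min_def C_def d_def mem_Times_iff)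
  \<comment> \<open>The range includes \<open>T\<close>: the last iterate is compared with
    \<open>Fstar\<close> at the end.\<close>
  have \<theta>_C: "\<theta> t \<in> C" if "t \<le> T" for t
    using that
  proof (induction t)
    case 0
    then show ?case
      using run by (simp add: cr_varpro_run_def C_def)
  next
    case (Suc t)
    then have "(1 - \<alpha> t) *\<^sub>R \<theta> t + \<alpha> t *\<^sub>R (\<theta> t + d t) \<in> C"
      using \<alpha>[of t] \<theta>bar_C[of t] by (intro convexD_alt[OF \<open>convex C\<close>]) auto
    then show ?case
      using update[of t] Suc.prems by (simp add: algebra_simps)
  qed
  \<comment> \<open>The current iterate is itself feasible in both linear subproblems, its second
    block being the centre of the ball.\<close>
  have gap_nonneg: "0 \<le> g t" if t: "t < T" for t
  proof -
    have "fst (\<theta> t) \<in> CA"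
      using \<theta>_C[of t] t by (auto simp: C_def)
    then have "inner (fst (\<theta>bar t)) (fst (grad F (\<theta> t))) \<le> inner (fst (\<theta> t)) (fst (grad F (\<theta> t)))"
      using oracle_A[OF t] by (simp add: is_arg_min_linorder)
    moreover have "inner (snd (\<theta>bar t)) (snd (grad F (\<theta> t))) \<le> inner (snd (\<theta> t)) (snd (grad F (\<theta> t)))"
      using oracle_B[OF t] by (simp add: is_arg_min_linorder)
    ultimately show ?thesis
      by (simp add: g_def d_def inner_prod_def inner_diff_right inner_commute)
  qed
  have \<Delta>bar: "\<Delta>bar\<^sup>2 = \<Delta>A\<^sup>2 + 1"
    by (simp add: \<Delta>bar_def)
  have K: "0 < L * \<Delta>bar\<^sup>2"
    using L by (simp add: \<Delta>bar add_nonneg_pos)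
  \<comment> \<open>The squared product norm splits into the two blocks: the diameter of
    \<open>CA\<close> bounds the first, the unit radius the second.\<close>
  have norm_d: "(norm (d t))\<^sup>2 \<le> \<Delta>bar\<^sup>2" if t: "t < T" for t
  proof -
    have "norm (fst (d t)) \<le> \<Delta>A"
      using diameter_bounded_bound[OF compact_imp_bounded[OF CA(2)], of "fst (\<theta>bar t)" "fst (\<theta> t)"]
        \<theta>_C[of t] \<theta>bar_C[OF t] t
      by (auto simp: \<Delta>A_def d_def C_def dist_norm mem_Times_iff)
    then have "(norm (fst (d t)))\<^sup>2 \<le> \<Delta>A\<^sup>2"
      by (intro power_mono) auto
    moreover have "norm (snd (d t)) \<le> 1"
      using oracle_B[OF t] by (simp add: is_arg_min_def d_def)
    then have "(norm (snd (d t)))\<^sup>2 \<le> 1"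
      by (simp add: power_le_one)
    ultimately show ?thesis
      by (simp add: norm_prod_def \<Delta>bar)
  qed
  have \<alpha>bar_nonneg: "0 \<le> \<alpha>bar t" if "t < T" for t
    using gap_nonneg[OF that] K by (simp add: \<alpha>bar_def)
  have level: "F (\<theta> t) \<le> F (\<theta> 0)" if "t \<le> T" for t
    using that
  proof (induction t)
    case (Suc t)
    then have "0 \<le> \<rho> * \<alpha>bar t * g t"
      using rho \<alpha>bar_nonneg[of t] gap_nonneg[of t] by simp
    then show ?case
      using Suc decrease[of t] by simp
  qed simp
  have progress: "min (g t / 2) (\<rho> * (g t)\<^sup>2 / (L * \<Delta>bar\<^sup>2)) \<le> F (\<theta> t) - F (\<theta> (Suc t))"
    if t: "t < T" for t
  proof (cases "L * \<Delta>bar\<^sup>2 \<le> g t")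
    case True
    then have "\<alpha>bar t = 1"
      using K by (simp add: \<alpha>bar_def)
    \<comment> \<open>\<open>\<alpha> t\<close> is squeezed between \<open>\<alpha>bar t = 1\<close>
      and 1. The assumed decrease would give only \<open>\<rho> * g t\<close> here; the Lipschitz
      bound gives \<open>g t / 2\<close>, whence the second entry of the \<open>max\<close> is free
      of \<rho>.\<close>
    then have "\<theta> (Suc t) = \<theta> t + d t"
      using step[OF t] \<alpha>[OF t] update[OF t] by simp
    moreover have "F (\<theta> t + d t) \<le> F (\<theta> t) + inner (grad F (\<theta> t)) (d t) / 2"
    proof (rule full_step_descent[OF diff \<open>convex C\<close> _ _ lipschitz _ L])
      show "\<theta> t \<in> C" "\<theta> t + d t \<in> C" "F (\<theta> t) \<le> F (\<theta> 0)" "(norm (d t))\<^sup>2 \<le> \<Delta>bar\<^sup>2"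
        using t \<theta>_C \<theta>bar_C level norm_d by auto
      show "0 < - inner (grad F (\<theta> t)) (d t)" "L * \<Delta>bar\<^sup>2 \<le> - inner (grad F (\<theta> t)) (d t)"
        using True K by (auto simp: g_def)
    qed
    ultimately show ?thesis
      by (simp add: g_def)
  next
    case False
    then have "\<alpha>bar t = g t / (L * \<Delta>bar\<^sup>2)"
      using K by (simp add: \<alpha>bar_def min_def)
    then show ?thesis
      using decrease[OF t] by (simp add: power2_eq_square)
  qed
  have "Fstar \<le> F (\<theta> T)"
    unfolding Fstar_def using bdd \<theta>_C[of T] by (intro cINF_lower) auto
  from min_gap_le[OF T rho K gap_nonneg progress this] show ?thesis .
qed

end
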